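(* Let $\theta \in (0,1]$. For all $n \geq 1$ there is a sequence $(b_i)_{i=1}^n \in U_n(\theta)$ such that \[ u_n(\theta) = \sum_{i=1}^n \frac{1}{b_i} < \theta. \] In particular, $u_n(\theta)$ is a rational number.
   Context: For $\theta \in (0,1]$ and $n\ge 1$, $U_n(\theta)$ is the set of all sequences of integers $(x_i)_{i=1}^n$ with $2 \leq x_1 \leq x_2 \leq \cdots \leq x_n$ and $\sum_{i=1}^n \frac{1}{x_i} < \theta$ (the $n$-term Egyptian underapproximation sequences of $\theta$), and $u_n(\theta) = \sup\left\{ \sum_{i=1}^n \frac{1}{x_i} : (x_i)_{i=1}^n \in U_n(\theta)\right\}$ (the best $n$-term Egyptian underapproximation of $\theta$). *)

theory Defs
  imports Complex_Main
begin

definition egyptian_sum :: "int list \<Rightarrow> real" where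
  "egyptian_sum xs = (\<Sum>x\<leftarrow>xs. 1 / real_of_int x)"

(* A sequence (x_1, ..., x_n) is a list of length n; sortedness of 2 # xs is the
   chain 2 <= x_1 <= x_2 <= ... <= x_n. *)
definition underapprox_seqs :: "nat \<Rightarrow> real \<Rightarrow> int list set" where
  "underapprox_seqs n \<theta> =
     {xs. length xs = n \<and> sorted (2 # xs) \<and> egyptian_sum xs < \<theta>}"

(* For \<theta> > 0 the set of sums is nonempty (large denominators) and bounded above by
   \<theta>, so Sup on the reals is the actual least upper bound here. *)
definition best_underapprox :: "nat \<Rightarrow> real \<Rightarrow> real" where
  "best_underapprox n \<theta> = Sup {egyptian_sum xs | xs. xs \<in> underapprox_seqs n \<theta>}"

end

theory Submission
  imports Defs "HOL-Library.Multiset"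
begin

text \<open>
  By induction on \<open>n\<close>, the maximum is attained for every \<open>\<theta> > 0\<close>. Fix \<open>N\<close> with
  \<open>(n + 1) / N < \<theta>\<close>. A sequence of \<open>n + 1\<close> terms that are all at least \<open>N\<close> does no better than
  the constant sequence \<open>N\<close>; any other one contains one of the finitely many \<open>x < N\<close>, and
  removing it leaves an \<open>n\<close>-term underapproximation of \<open>\<theta> - 1 / x\<close>, which the induction
  hypothesis bounds. So finitely many candidates suffice.
\<close>

lemma egyptian_sum_simps [simp]:
  "egyptian_sum [] = 0"
  "egyptian_sum (x # xs) = 1 / real_of_int x + egyptian_sum xs"
  by (simp_all add: egyptian_sum_def)

lemma egyptian_sum_replicate: "egyptian_sum (replicate n x) = real n / real_of_int x"
  by (induction n) (simp_all add: add_divide_distrib)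

lemma egyptian_sum_remove1:
  "x \<in> set xs \<Longrightarrow> egyptian_sum xs = 1 / real_of_int x + egyptian_sum (remove1 x xs)"
  unfolding egyptian_sum_def by (rule sum_list_map_remove1)

text \<open>The sum depends only on the multiset of terms, which sorting preserves.\<close>

lemma egyptian_sum_sort: "egyptian_sum (sort xs) = egyptian_sum xs"
  unfolding egyptian_sum_def by (simp flip: sum_mset_sum_list)

lemma egyptian_sum_nonneg: "\<forall>x\<in>set xs. 0 \<le> x \<Longrightarrow> 0 \<le> egyptian_sum xs"
  unfolding egyptian_sum_def by (rule sum_list_nonneg) auto

lemma egyptian_sum_le:
  "0 < N \<Longrightarrow> \<forall>x\<in>set xs. N \<le> x \<Longrightarrow> egyptian_sum xs \<le> real (length xs) / real_of_int N"
proof (induction xs)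
  case (Cons x xs)
  then have "1 / real_of_int x \<le> 1 / real_of_int N" by (simp add: frac_le)
  with Cons show ?case by (simp add: add_divide_distrib)
qed simp

lemma egyptian_sum_Rats: "egyptian_sum xs \<in> \<rat>"
  by (induction xs) auto

text \<open>Order is dropped so that an arbitrary term can be removed or put in front.\<close>

definition unsorted_seqs :: "nat \<Rightarrow> real \<Rightarrow> int list set" where
  "unsorted_seqs n \<theta> = {xs. length xs = n \<and> (\<forall>x\<in>set xs. 2 \<le> x) \<and> egyptian_sum xs < \<theta>}"

lemma underapprox_seqs_subset_unsorted: "underapprox_seqs n \<theta> \<subseteq> unsorted_seqs n \<theta>"
  by (auto simp: underapprox_seqs_def unsorted_seqs_def)

lemma sort_in_underapprox_seqs: "xs \<in> unsorted_seqs n \<theta> \<Longrightarrow> sort xs \<in> underapprox_seqs n \<theta>"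
  by (auto simp: underapprox_seqs_def unsorted_seqs_def egyptian_sum_sort)

lemma remove1_in_unsorted_seqs:
  assumes "xs \<in> unsorted_seqs (Suc n) \<theta>" and "x \<in> set xs"
  shows "remove1 x xs \<in> unsorted_seqs n (\<theta> - 1 / real_of_int x)"
  using assms egyptian_sum_remove1[of x xs] set_remove1_subset[of x xs]
  by (auto simp: unsorted_seqs_def length_remove1)

text \<open>A sum of nonnegative terms lies strictly below \<open>\<theta>\<close>. This makes the
  threshold left after removing a term positive, as the induction hypothesis requires.\<close>

lemma unsorted_seqs_pos: "xs \<in> unsorted_seqs n \<theta> \<Longrightarrow> 0 < \<theta>"
  using egyptian_sum_nonneg[of xs] by (force simp: unsorted_seqs_def)

lemma unsorted_seqs_max:
  assumes "0 < \<theta>"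
  shows "\<exists>b\<in>unsorted_seqs n \<theta>. \<forall>xs\<in>unsorted_seqs n \<theta>. egyptian_sum xs \<le> egyptian_sum b"
  using assms
\<comment> \<open>\<open>\<theta>\<close> varies because removing a term \<open>x\<close> lowers the
  threshold to \<open>\<theta> - 1 / x\<close>.\<close>
proof (induction n arbitrary: \<theta>)
  case 0
  then show ?case by (auto simp: unsorted_seqs_def)
next
  case (Suc n)
  \<comment> \<open>Choose maximizers for all positive thresholds at once, since each first term
    \<open>x\<close> gives a different one.\<close>
  obtain B where B: "\<And>t. 0 < t \<Longrightarrow> B t \<in> unsorted_seqs n t"
    and B_max: "\<And>t xs. 0 < t \<Longrightarrow> xs \<in> unsorted_seqs n t \<Longrightarrow> egyptian_sum xs \<le> egyptian_sum (B t)"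
    using Suc.IH by metis
  obtain k :: nat where k: "real (Suc n) / \<theta> < real k"
    using reals_Archimedean2 by blast
  \<comment> \<open>The bound 2 makes the constant sequence \<open>N\<close> admissible; raising
    \<open>k\<close> to 2 only shrinks its sum.\<close>
  define N where "N = max 2 (int k)"
  have "N \<ge> 2" and "real (Suc n) / \<theta> < real_of_int N"
    using k by (auto simp: N_def max_def)
  then have N: "real (Suc n) / real_of_int N < \<theta>"
    using Suc.prems by (simp add: field_simps)
  \<comment> \<open>The condition on \<open>x\<close> keeps \<open>\<theta> - 1 / x\<close>
    positive, where \<open>B\<close> is specified.\<close>
  define X where "X = {x \<in> {2..N}. 1 / real_of_int x < \<theta>}"
  define C where
    "C = insert (replicate (Suc n) N) ((\<lambda>x. x # B (\<theta> - 1 / real_of_int x)) ` X)"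
  have "finite X" by (rule finite_subset[of _ "{2..N}"]) (auto simp: X_def)
  then have "finite C" "C \<noteq> {}" by (simp_all add: C_def)
  then have "Max (egyptian_sum ` C) \<in> egyptian_sum ` C" by simp
  then obtain b where "b \<in> C" and "Max (egyptian_sum ` C) = egyptian_sum b" by auto
  then have b_max: "egyptian_sum c \<le> egyptian_sum b" if "c \<in> C" for c
    using that \<open>finite C\<close> by (metis Max_ge finite_imageI imageI)
  have "replicate (Suc n) N \<in> unsorted_seqs (Suc n) \<theta>"
    using \<open>N \<ge> 2\<close> N egyptian_sum_replicate[of "Suc n" N] by (simp add: unsorted_seqs_def)
  \<comment> \<open>The term \<open>x\<close> may exceed entries of the tail, so this list need not
    be sorted.\<close>
  moreover have "x # B (\<theta> - 1 / real_of_int x) \<in> unsorted_seqs (Suc n) \<theta>" if "x \<in> X" for x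
    using that B[of "\<theta> - 1 / real_of_int x"] by (auto simp: X_def unsorted_seqs_def)
  ultimately have "b \<in> unsorted_seqs (Suc n) \<theta>"
    using \<open>b \<in> C\<close> by (auto simp: C_def)
  moreover have "egyptian_sum xs \<le> egyptian_sum b" if xs: "xs \<in> unsorted_seqs (Suc n) \<theta>" for xs
  proof (cases "\<forall>x\<in>set xs. N \<le> x")
    case True
    then have "egyptian_sum xs \<le> egyptian_sum (replicate (Suc n) N)"
      using egyptian_sum_le[of N xs] xs \<open>N \<ge> 2\<close> egyptian_sum_replicate[of "Suc n" N]
      by (simp add: unsorted_seqs_def)
    also have "\<dots> \<le> egyptian_sum b"
      by (rule b_max) (simp add: C_def)
    finally show ?thesis .
  next
    case False
    then obtain x where x: "x \<in> set xs" "x < N" by auto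
    have rest: "remove1 x xs \<in> unsorted_seqs n (\<theta> - 1 / real_of_int x)"
      using remove1_in_unsorted_seqs xs x(1) .
    then have pos: "0 < \<theta> - 1 / real_of_int x" by (rule unsorted_seqs_pos)
    then have "x \<in> X" using x xs by (auto simp: X_def unsorted_seqs_def)
    \<comment> \<open>Keep \<open>x\<close> and replace the other terms by the best ones for the
      remaining threshold.\<close>
    have "egyptian_sum xs \<le> egyptian_sum (x # B (\<theta> - 1 / real_of_int x))"
      using B_max[OF pos rest] egyptian_sum_remove1[OF x(1)] by simp
    also have "\<dots> \<le> egyptian_sum b"
      using \<open>x \<in> X\<close> by (intro b_max) (simp add: C_def)
    finally show ?thesis .
  qed
  ultimately show ?case by blast
qed

theorem theorem3p1:
  fixes \<theta> :: real
  assumes "0 < \<theta>" and "\<theta> \<le> 1"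
  shows "\<forall>n::nat. n \<ge> 1 \<longrightarrow>
           (\<exists>b \<in> underapprox_seqs n \<theta>.
              best_underapprox n \<theta> = egyptian_sum b \<and> egyptian_sum b < \<theta>)
           \<and> best_underapprox n \<theta> \<in> \<rat>"
proof (intro allI impI)
  fix n :: nat
  obtain c where "c \<in> unsorted_seqs n \<theta>"
    and c_max: "\<And>xs. xs \<in> unsorted_seqs n \<theta> \<Longrightarrow> egyptian_sum xs \<le> egyptian_sum c"
    using unsorted_seqs_max[OF assms(1)] by blast
  then have b: "sort c \<in> underapprox_seqs n \<theta>"
    by (simp add: sort_in_underapprox_seqs)
  have "best_underapprox n \<theta> = egyptian_sum (sort c)"
    unfolding best_underapprox_def
  \<comment> \<open>An attained upper bound is the supremum. Sorted lists are among the unsorted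
    ones, so \<open>c\<close> bounds them, and \<open>sort c\<close> attains the same sum.\<close>
  proof (rule cSup_eq_maximum)
    show "egyptian_sum (sort c) \<in> {egyptian_sum xs |xs. xs \<in> underapprox_seqs n \<theta>}"
      using b by blast
  qed (use c_max underapprox_seqs_subset_unsorted in \<open>auto simp: egyptian_sum_sort\<close>)
  then show "(\<exists>b \<in> underapprox_seqs n \<theta>.
              best_underapprox n \<theta> = egyptian_sum b \<and> egyptian_sum b < \<theta>)
           \<and> best_underapprox n \<theta> \<in> \<rat>"
    using b egyptian_sum_Rats[of "sort c"] by (metis (lifting) mem_Collect_eq underapprox_seqs_def)
qed

end
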